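(* Let $\mathcal{L}^1_\Delta,\mathcal{L}^2_\Delta:\mathbb{R}^{L\times Q}\to\mathbb{R}^{L\times Q}$, with $\Delta:=\Delta t$, be the operators $$\mathcal{L}^2_\Delta(u):=u-B^{-1}\big[r-\widetilde\phi(u)\big],\qquad \mathcal{L}^1_\Delta(u):=u-B^{-1}\big[r-\widetilde\phi(u_0)\big],$$ where $B$, $r$, $\widetilde\phi$ are the ADER-DG space-time predictor structures on the control volume $C_K$ given in the context, and $u_0\in\mathbb{R}^{L\times Q}$ is a fixed coefficient vector. Then, with $X=Y=\mathbb{R}^{L\times Q}$ endowed with the infinity norm and for $\Delta t$ small enough: 1. there exists a unique $u_\Delta\in\mathbb{R}^{L\times Q}$ such that $\mathcal{L}^2_\Delta(u_\Delta)=0$; 2. there exists $\alpha_1>0$ independent of $\Delta$ such that $\|\mathcal{L}^1_\Delta(v)-\mathcal{L}^1_\Delta(w)\|_\infty\ge\alpha_1\|v-w\|_\infty$ for all $v,w\in\mathbb{R}^{L\times Q}$; 3. there exists $\alpha_2\ge 0$ independent of $\Delta$ such that $\big\|[\mathcal{L}^1_\Delta(v)-\mathcal{L}^2_\Delta(v)]-[\mathcal{L}^1_\Delta(w)-\mathcal{L}^2_\Delta(w)]\big\|_\infty\le\alpha_2\,\Delta\,\|v-w\|_\infty$ for all $v,w\in\mathbb{R}^{L\times Q}$.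
   Context: Setting. Consider the $Q$-dimensional hyperbolic PDE $\partial_t u(x,t)+E(u(x,t),x)=0$ on $\Omega\times\mathbb{R}^+_0$, $\Omega\subseteq\mathbb{R}^D$ bounded, where $E(u,x):=\mathrm{div}_x F(u)-S(x,u)$ with flux $F:\mathbb{R}^Q\to\mathbb{R}^{Q\times D}$ and source $S:\overline\Omega\times\mathbb{R}^Q\to\mathbb{R}^Q$. $\mathcal{T}_h$ is a tessellation of $\overline\Omega$ into non-overlapping convex polytopes $K$ with mesh parameter $h$; $|K|$ is the volume of $K$. Let $[t_n,t_{n+1}]$ be a time step, $\Delta t=t_{n+1}-t_n$, $C_K=K\times[t_n,t_{n+1}]$, and let $u_n:K\to\mathbb{R}^Q$ be the known (polynomial of degree at most $M$) approximate solution at $t_n$. Basis. $\{\varphi_i\}_{i=1}^I$ is a basis of $\mathbb{P}_M(K)$, $\{\psi^m\}_{m=0}^M$ a basis of the polynomials of degree at most $M$ on $[t_n,t_{n+1}]$, and $\{\vartheta^\ell\}_{\ell=1}^L$ is an enumeration of the products $\varphi_i(x)\psi^m(t)$. A coefficient vector $u=(u^1,\dots,u^L)\in\mathbb{R}^{L\times Q}$, $u^\ell\in\mathbb{R}^Q$, represents $u_h(x,t)=\sum_{\ell=1}^L u^\ell\vartheta^\ell(x,t)$ on $C_K$; likewise $v\leftrightarrow v_h$, $w\leftrightarrow w_h$. Predictor structures. For $j,\ell=1,\dots,L$, $$B_{j,\ell}:=\int_K\vartheta^\ell(x,t_{n+1})\vartheta^j(x,t_{n+1})\,dx-\int_{C_K}\vartheta^\ell(x,t)\,\partial_t\vartheta^j(x,t)\,dx\,dt,$$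 $$r_j:=\int_K u_n(x)\vartheta^j(x,t_n)\,dx\in\mathbb{R}^Q,\qquad \widetilde\phi_j(u):=\int_{t_n}^{t_{n+1}}\int_K E(u_h(x,t),x)\,\vartheta^j(x,t)\,dx\,dt\in\mathbb{R}^Q .$$ $B$ acts on $\mathbb{R}^{L\times Q}$ componentwise in the $Q$ index (block expansion). The vector $u_0$ contains the local space-time coefficients of an $O(\Delta t)$-approximation of the analytical solution in $C_K$, e.g. such that $\sum_\ell u_0^\ell\vartheta^\ell(x,t)=u_n(x)$ for all $t\in[t_n,t_{n+1}]$. Norm. $\|\cdot\|_\infty$ on $\mathbb{R}^{L\times Q}$ is the maximum of the absolute values of the entries; on matrices it is the induced norm; $\|\cdot\|_{\infty,Q}$ is the maximum norm on $\mathbb{R}^Q$. Standing assumptions (constants independent of $\Delta t$ and of $K$): (a) normalization: $|\vartheta^j|\le C_\vartheta$ on $C_K$ for all $j$; (b) smooth data: $\|E(v_h(x,t),x)-E(w_h(x,t),x)\|_{\infty,Q}\le C_0\|v-w\|_\infty$ for all $(x,t)\in C_K$ and all $v,w\in\mathbb{R}^{L\times Q}$; (c) regular mesh: $|K|\le C_\tau h^D$; (d) scaling of $B$: $B$ is invertible and $\|B^{-1}\|_\infty\le C_B h^{-D}$. *)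

theory Defs
  imports "HOL-Analysis.Analysis"
begin

definition tessellation :: "(real^'d) set \<Rightarrow> (real^'d) set set \<Rightarrow> bool" where
  "tessellation \<Omega> T \<longleftrightarrow>
     finite T \<and> (\<forall>K\<in>T. polytope K \<and> interior K \<noteq> {}) \<and>
     pairwise (\<lambda>K K'. interior K \<inter> interior K' = {}) T \<and> \<Union>T = closure \<Omega>"

(* Polynomial functions of total degree at most M in CARD('d) variables. *)
definition poly_space :: "nat \<Rightarrow> (real^'d \<Rightarrow> real) set" where
  "poly_space M = {p. \<exists>c. p = (\<lambda>x. \<Sum>a\<in>{a::'d \<Rightarrow> nat. sum a UNIV \<le> M}. c a * (\<Prod>i\<in>UNIV. (x $ i) ^ a i))}"

definition time_poly_space :: "nat \<Rightarrow> (real \<Rightarrow> real) set" where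
  "time_poly_space M = {poly p |p. degree p \<le> M}"

(* The family (f j), j in J, is a basis of the space of restrictions to A of functions in V. *)
definition basis_on :: "'a set \<Rightarrow> ('a \<Rightarrow> real) set \<Rightarrow> 'i set \<Rightarrow> ('i \<Rightarrow> 'a \<Rightarrow> real) \<Rightarrow> bool" where
  "basis_on A V J f \<longleftrightarrow>
     finite J \<and> (\<forall>j\<in>J. f j \<in> V) \<and>
     (\<forall>p\<in>V. \<exists>c. \<forall>x\<in>A. p x = (\<Sum>j\<in>J. c j * f j x)) \<and>
     (\<forall>c. (\<forall>x\<in>A. (\<Sum>j\<in>J. c j * f j x) = 0) \<longrightarrow> (\<forall>j\<in>J. c j = 0))"

(* theta enumerates, by the index type 'l, the products phi_i(x) psi^m(t). Basis functions are
   polynomials and are taken as functions on the whole space, so that they can be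
   differentiated at boundary points of K and of [t0, t1]. *)
definition space_time_basis ::
  "nat \<Rightarrow> (real^'d) set \<Rightarrow> real \<Rightarrow> real \<Rightarrow> ('l::finite \<Rightarrow> real^'d \<Rightarrow> real \<Rightarrow> real) \<Rightarrow> bool" where
  "space_time_basis M K t0 t1 \<theta> \<longleftrightarrow>
     (\<exists>N (\<phi> :: nat \<Rightarrow> real^'d \<Rightarrow> real) (\<psi> :: nat \<Rightarrow> real \<Rightarrow> real) e.
        basis_on K (poly_space M) {1..N} \<phi> \<and>
        basis_on {t0..t1} (time_poly_space M) {0..M} \<psi> \<and>
        bij_betw e (UNIV :: 'l set) ({1..N} \<times> {0..M}) \<and>
        (\<forall>l x t. \<theta> l x t = \<phi> (fst (e l)) x * \<psi> (snd (e l)) t))"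

definition st_fun ::
  "('l::finite \<Rightarrow> real^'d \<Rightarrow> real \<Rightarrow> real) \<Rightarrow> real^'q^'l \<Rightarrow> real^'d \<Rightarrow> real \<Rightarrow> real^'q" where
  "st_fun \<theta> u x t = (\<Sum>l\<in>UNIV. \<theta> l x t *\<^sub>R (u $ l))"

(* Row-wise divergence of a matrix field. *)
definition divergence :: "(real^'d \<Rightarrow> real^'d^'q) \<Rightarrow> real^'d \<Rightarrow> real^'q" where
  "divergence G x = (\<chi> q. \<Sum>d\<in>UNIV. deriv (\<lambda>s. G (x + s *\<^sub>R axis d 1) $ q $ d) 0)"

(* E(u, x) = div_x F(u) - S(x, u) involves spatial derivatives of u, so the argument u is a
   function of space and not just a value. *)
definition spatial_op ::
  "(real^'q \<Rightarrow> real^'d^'q) \<Rightarrow> (real^'d \<Rightarrow> real^'q \<Rightarrow> real^'q) \<Rightarrow>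
   (real^'d \<Rightarrow> real^'q) \<Rightarrow> real^'d \<Rightarrow> real^'q" where
  "spatial_op F S u x = divergence (\<lambda>y. F (u y)) x - S x (u x)"

definition predB ::
  "(real^'d) set \<Rightarrow> real \<Rightarrow> real \<Rightarrow> ('l::finite \<Rightarrow> real^'d \<Rightarrow> real \<Rightarrow> real) \<Rightarrow> real^'l^'l" where
  "predB K t0 t1 \<theta> = (\<chi> j l.
     (LINT x:K|lborel. \<theta> l x t1 * \<theta> j x t1)
     - (LINT z:K \<times> {t0..t1}|lborel. \<theta> l (fst z) (snd z) * deriv (\<theta> j (fst z)) (snd z)))"

definition predr ::
  "(real^'d) set \<Rightarrow> real \<Rightarrow> ('l::finite \<Rightarrow> real^'d \<Rightarrow> real \<Rightarrow> real) \<Rightarrow> (real^'d \<Rightarrow> real^'q) \<Rightarrow> real^'q^'l" where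
  "predr K t0 \<theta> un = (\<chi> j. LINT x:K|lborel. \<theta> j x t0 *\<^sub>R un x)"

definition predphi ::
  "(real^'q \<Rightarrow> real^'d^'q) \<Rightarrow> (real^'d \<Rightarrow> real^'q \<Rightarrow> real^'q) \<Rightarrow>
   (real^'d) set \<Rightarrow> real \<Rightarrow> real \<Rightarrow> ('l::finite \<Rightarrow> real^'d \<Rightarrow> real \<Rightarrow> real) \<Rightarrow>
   real^'q^'l \<Rightarrow> real^'q^'l" where
  "predphi F S K t0 t1 \<theta> u = (\<chi> j. LINT t:{t0..t1}|lborel. LINT x:K|lborel.
     \<theta> j x t *\<^sub>R spatial_op F S (\<lambda>y. st_fun \<theta> u y t) x)"

(* A coefficient vector is an L x Q matrix, so the block expansion of an L x L matrix A acts on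
   it by the matrix product A ** u. *)
definition L2op ::
  "(real^'q \<Rightarrow> real^'d^'q) \<Rightarrow> (real^'d \<Rightarrow> real^'q \<Rightarrow> real^'q) \<Rightarrow>
   (real^'d) set \<Rightarrow> real \<Rightarrow> real \<Rightarrow> ('l::finite \<Rightarrow> real^'d \<Rightarrow> real \<Rightarrow> real) \<Rightarrow>
   (real^'d \<Rightarrow> real^'q) \<Rightarrow> real^'q^'l \<Rightarrow> real^'q^'l" where
  "L2op F S K t0 t1 \<theta> un u =
     u - matrix_inv (predB K t0 t1 \<theta>) ** (predr K t0 \<theta> un - predphi F S K t0 t1 \<theta> u)"

definition L1op ::
  "(real^'q \<Rightarrow> real^'d^'q) \<Rightarrow> (real^'d \<Rightarrow> real^'q \<Rightarrow> real^'q) \<Rightarrow>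
   (real^'d) set \<Rightarrow> real \<Rightarrow> real \<Rightarrow> ('l::finite \<Rightarrow> real^'d \<Rightarrow> real \<Rightarrow> real) \<Rightarrow>
   (real^'d \<Rightarrow> real^'q) \<Rightarrow> real^'q^'l \<Rightarrow> real^'q^'l \<Rightarrow> real^'q^'l" where
  "L1op F S K t0 t1 \<theta> un u0 u =
     u - matrix_inv (predB K t0 t1 \<theta>) ** (predr K t0 \<theta> un - predphi F S K t0 t1 \<theta> u0)"

(* Operator norm induced by infnorm, the analogue of onorm. On real^'q^'l, infnorm is the
   maximum of the absolute values of all entries. *)
definition induced_infnorm :: "('a::euclidean_space \<Rightarrow> 'b::euclidean_space) \<Rightarrow> real" where
  "induced_infnorm f = (SUP u. infnorm (f u) / infnorm u)"

end

(* L1(u) - L2(u) = A(phi(u0) - phi(u)), where A is the inverse of the predictor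
   matrix. The normalization of the basis functions, the Lipschitz bound on the spatial operator
   and Fubini's theorem give infnorm (phi v - phi w) <= Ctheta C0 |K| Dt infnorm (v - w), and the
   factors h^D and h^-D coming from |K| and A cancel. Hence u |-> A(r - phi u) is Lipschitz with
   constant proportional to Dt, and for small Dt Banach's theorem gives the unique zero. *)
theory Submission
  imports Defs
begin

lemma infnorm_le_iff: "infnorm x \<le> c \<longleftrightarrow> (\<forall>b\<in>Basis. \<bar>x \<bullet> b\<bar> \<le> c)"
  for x :: "'a::euclidean_space"
  by (simp add: infnorm_Max)

text \<open>Each basis vector of \<open>('a)^'n\<close> is supported in a single component, so a
  coefficient vector can be estimated row by row without losing a constant.\<close>

lemma infnorm_vec_le:
  fixes x :: "('a::euclidean_space)^'n"
  assumes "\<And>i. infnorm (x $ i) \<le> c"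
  shows "infnorm x \<le> c"
  using assms by (auto simp: infnorm_le_iff Basis_vec_def inner_axis)

text \<open>A real supremum is informative only if the quotients are bounded above. They are, since
  a linear map in finite dimension is bounded in the Euclidean norm and the two norms are
  equivalent.\<close>

lemma infnorm_le_induced_infnorm:
  fixes f :: "'a::euclidean_space \<Rightarrow> 'b::euclidean_space"
  assumes "linear f"
  shows "infnorm (f u) \<le> induced_infnorm f * infnorm u"
proof (cases "u = 0")
  case True
  then show ?thesis using linear_0[OF assms] by (simp add: infnorm_0)
next
  case False
  obtain B where B: "0 < B" "\<And>x. norm (f x) \<le> B * norm x"
    using linear_bounded_pos[OF assms] by blast
  \<comment> \<open>The factor \<open>sqrt DIM('a)\<close> bounds \<open>norm x\<close> by
    \<open>infnorm x\<close>; the passage from \<open>infnorm (f x)\<close> to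
    \<open>norm (f x)\<close> costs nothing. At \<open>x = 0\<close> the quotient is 0 by the
    convention for division.\<close>
  have "infnorm (f x) / infnorm x \<le> B * sqrt DIM('a)" for x
  proof (cases "x = 0")
    case True
    then show ?thesis using B(1) by (simp add: infnorm_0)
  next
    case False
    have "infnorm (f x) \<le> norm (f x)" by (rule infnorm_le_norm)
    also have "\<dots> \<le> B * norm x" by (rule B)
    also have "\<dots> \<le> B * (sqrt DIM('a) * infnorm x)"
      using B(1) norm_le_infnorm[of x] by (intro mult_left_mono) auto
    finally show ?thesis
      using False by (simp add: pos_divide_le_eq infnorm_pos_lt mult.assoc)
  qed
  then have "bdd_above (range (\<lambda>x. infnorm (f x) / infnorm x))"
    by (intro bdd_aboveI2)
  then have "infnorm (f u) / infnorm u \<le> induced_infnorm f"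
    unfolding induced_infnorm_def by (intro cSUP_upper) auto
  then show ?thesis
    using False by (simp add: pos_divide_le_eq infnorm_pos_lt)
qed

text \<open>Taking one coordinate at a time reduces the bound to the scalar triangle inequality for
  integrals, so no factor depending on the dimension appears.\<close>

lemma infnorm_set_integral_le:
  fixes f :: "'a \<Rightarrow> 'b::euclidean_space"
  assumes f: "set_integrable M A f"
    and A: "A \<in> sets M" "emeasure M A < \<infinity>"
    and bound: "\<And>x. x \<in> A \<Longrightarrow> infnorm (f x) \<le> C"
  shows "infnorm (LINT x:A|M. f x) \<le> C * measure M A"
  unfolding infnorm_le_iff
proof
  fix b :: 'b assume b: "b \<in> Basis"
  let ?g = "\<lambda>x. indicator A x *\<^sub>R f x"
  have g: "integrable M ?g" using f by (simp add: set_integrable_def)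
  have "\<bar>(LINT x:A|M. f x) \<bullet> b\<bar> = \<bar>LINT x|M. ?g x \<bullet> b\<bar>"
    using g by (simp add: set_lebesgue_integral_def del: inner_scaleR_left)
  also have "\<dots> \<le> (LINT x|M. \<bar>?g x \<bullet> b\<bar>)"
    by (rule integral_abs_bound)
  also have "\<dots> \<le> (LINT x|M. C * indicator A x)"
  proof (rule integral_mono)
    show "integrable M (\<lambda>x. \<bar>?g x \<bullet> b\<bar>)"
      using g by (intro integrable_abs integrable_inner_left) auto
    show "integrable M (\<lambda>x. C * indicator A x)"
      using A by (intro integrable_mult_right integrable_real_indicator) auto
    \<comment> \<open>Off \<open>A\<close> both sides vanish; on \<open>A\<close> each coordinate is
      dominated by the infinity norm.\<close>
    show "\<bar>?g x \<bullet> b\<bar> \<le> C * indicator A x" for x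
      using bound[of x] Basis_le_infnorm[OF b, of "f x"] by (auto simp: indicator_def)
  qed
  also have "\<dots> = C * measure M A"
    using A by simp
  finally show "\<bar>(LINT x:A|M. f x) \<bullet> b\<bar> \<le> C * measure M A" .
qed

text \<open>Fubini's theorem in the order of integration of \<open>predphi\<close>: space inside,
  time outside.\<close>

lemma set_integral_lborel_Times:
  fixes f :: "'a::euclidean_space \<times> 'b::euclidean_space \<Rightarrow> 'c::euclidean_space"
  assumes "set_integrable lborel (A \<times> B) f"
  shows "(LINT y:B|lborel. LINT x:A|lborel. f (x, y)) = (LINT z:A \<times> B|lborel. f z)"
proof -
  let ?g = "\<lambda>x y. indicator (A \<times> B) (x, y) *\<^sub>R f (x, y)"
  have g: "integrable (lborel \<Otimes>\<^sub>M lborel) (case_prod ?g)"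
    using assms by (simp add: set_integrable_def lborel_prod case_prod_unfold)
  \<comment> \<open>The indicator of \<open>B\<close> is constant for the inner integral; moved
    inside, it merges with that of \<open>A\<close>.\<close>
  have "(LINT y:B|lborel. LINT x:A|lborel. f (x, y)) = (LINT y|lborel. LINT x|lborel. ?g x y)"
    unfolding set_lebesgue_integral_def
    by (simp add: indicator_times scaleR_left_commute flip: integral_scaleR_right scaleR_scaleR)
  also have "\<dots> = integral\<^sup>L (lborel \<Otimes>\<^sub>M lborel) (case_prod ?g)"
    by (rule lborel_pair.integral_snd[OF g])
  also have "\<dots> = (LINT z:A \<times> B|lborel. f z)"
    by (simp add: set_lebesgue_integral_def lborel_prod case_prod_unfold)
  finally show ?thesis .
qed

text \<open>The factor \<open>b - a\<close> in the volume is the source of the factor \<Delta> in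
  the final estimate.\<close>

lemma measure_lborel_compact_Times_Icc:
  fixes K :: "'a::euclidean_space set" and a b :: real
  assumes "compact K" "a \<le> b"
  shows "K \<times> {a..b} \<in> sets lborel"
    and "emeasure lborel (K \<times> {a..b}) < \<infinity>"
    and "measure lborel (K \<times> {a..b}) = measure lborel K * (b - a)"
proof -
  have "compact (K \<times> {a..b})" using assms by (intro compact_Times) auto
  then show "K \<times> {a..b} \<in> sets lborel" "emeasure lborel (K \<times> {a..b}) < \<infinity>"
    by (simp_all only: sets_lborel borel_compact emeasure_bounded_finite compact_imp_bounded)
  have "emeasure lborel (K \<times> {a..b}) = emeasure lborel K * emeasure lborel {a..b}"
    using lborel.emeasure_pair_measure_Times[of K lborel "{a..b}"] assms
    by (simp add: lborel_prod borel_compact)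
  then show "measure lborel (K \<times> {a..b}) = measure lborel K * (b - a)"
    using assms(2) by (simp add: measure_def enn2real_mult)
qed

text \<open>The bound is a pointwise bound on the integrand times the volume of the cylinder.
  Absolute values stand around the constants because no sign is assumed for them, while multiplying
  inequalities requires nonnegative factors.\<close>

lemma infnorm_predphi_diff_le:
  fixes F :: "real^'q \<Rightarrow> real^'d^'q"
    and \<theta> :: "'l::finite \<Rightarrow> real^'d \<Rightarrow> real \<Rightarrow> real"
    and v w :: "real^'q^'l"
  assumes K: "compact K" and t: "t0 \<le> t1"
    and int: "\<And>(u :: real^'q^'l) j. set_integrable lborel (K \<times> {t0..t1})
          (\<lambda>z. \<theta> j (fst z) (snd z) *\<^sub>R spatial_op F S (\<lambda>y. st_fun \<theta> u y (snd z)) (fst z))"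
    and \<theta>: "\<And>j x t. x \<in> K \<Longrightarrow> t \<in> {t0..t1} \<Longrightarrow> \<bar>\<theta> j x t\<bar> \<le> C\<theta>"
    and E: "\<And>x t. x \<in> K \<Longrightarrow> t \<in> {t0..t1} \<Longrightarrow>
          infnorm (spatial_op F S (\<lambda>y. st_fun \<theta> v y t) x - spatial_op F S (\<lambda>y. st_fun \<theta> w y t) x)
            \<le> C0 * infnorm (v - w)"
  shows "infnorm (predphi F S K t0 t1 \<theta> v - predphi F S K t0 t1 \<theta> w)
           \<le> \<bar>C\<theta>\<bar> * \<bar>C0\<bar> * infnorm (v - w) * (measure lborel K * (t1 - t0))"
proof (rule infnorm_vec_le)
  fix j
  let ?C = "K \<times> {t0..t1}"
  let ?f = "\<lambda>u z. \<theta> j (fst z) (snd z) *\<^sub>R spatial_op F S (\<lambda>y. st_fun \<theta> u y (snd z)) (fst z)"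
  have phi: "predphi F S K t0 t1 \<theta> u $ j = (LINT z:?C|lborel. ?f u z)" for u :: "real^'q^'l"
    using set_integral_lborel_Times[OF int[where u=u and j=j]] by (simp add: predphi_def)
  have "infnorm (?f v z - ?f w z) \<le> \<bar>C\<theta>\<bar> * \<bar>C0\<bar> * infnorm (v - w)" if "z \<in> ?C" for z
  proof -
    have z: "fst z \<in> K" "snd z \<in> {t0..t1}" using that by auto
    have "infnorm (?f v z - ?f w z) = \<bar>\<theta> j (fst z) (snd z)\<bar> *
        infnorm (spatial_op F S (\<lambda>y. st_fun \<theta> v y (snd z)) (fst z)
               - spatial_op F S (\<lambda>y. st_fun \<theta> w y (snd z)) (fst z))"
      by (simp add: infnorm_mul flip: scaleR_diff_right)
    also have "\<dots> \<le> \<bar>C\<theta>\<bar> * (\<bar>C0\<bar> * infnorm (v - w))"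
    proof (rule mult_mono)
      show "\<bar>\<theta> j (fst z) (snd z)\<bar> \<le> \<bar>C\<theta>\<bar>" using \<theta>[OF z, of j] by linarith
      show "infnorm (spatial_op F S (\<lambda>y. st_fun \<theta> v y (snd z)) (fst z)
               - spatial_op F S (\<lambda>y. st_fun \<theta> w y (snd z)) (fst z)) \<le> \<bar>C0\<bar> * infnorm (v - w)"
        using E[OF z] mult_right_mono[OF abs_ge_self infnorm_pos_le, of C0 "v - w"] by linarith
    qed (auto simp: infnorm_pos_le)
    finally show ?thesis by (simp add: mult.assoc)
  qed
  then have "infnorm (LINT z:?C|lborel. ?f v z - ?f w z)
      \<le> \<bar>C\<theta>\<bar> * \<bar>C0\<bar> * infnorm (v - w) * measure lborel ?C"
    by (intro infnorm_set_integral_le set_integral_diff(1) int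
          measure_lborel_compact_Times_Icc[OF K t])
  then show "infnorm ((predphi F S K t0 t1 \<theta> v - predphi F S K t0 t1 \<theta> w) $ j)
      \<le> \<bar>C\<theta>\<bar> * \<bar>C0\<bar> * infnorm (v - w) * (measure lborel K * (t1 - t0))"
    by (simp add: phi set_integral_diff(2)[OF int int] measure_lborel_compact_Times_Icc[OF K t])
qed

lemma matrix_diff_ldistrib: "A ** (B - C) = A ** B - A ** C"
  for A :: "'a::ring_1^'n^'m"
  using matrix_add_ldistrib[of A "B - C" C] by (simp add: algebra_simps)

lemma linear_matrix_mult_left: "linear (\<lambda>u :: real^'q^'n. A ** u)"
  for A :: "real^'n^'m"
  by (rule linearI)
    (simp_all add: vec_eq_iff matrix_matrix_mult_def sum_distrib_left sum.distrib algebra_simps)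

(* Banach's theorem is applied in the Euclidean metric of the type, which costs sqrt DIM. *)
lemma infnorm_contraction_fixpoint:
  fixes f :: "'a::euclidean_space \<Rightarrow> 'a"
  assumes "0 \<le> c" "sqrt DIM('a) * c < 1"
    and lip: "\<And>x y. infnorm (f x - f y) \<le> c * infnorm (x - y)"
  shows "\<exists>!x. f x = x"
proof (rule banach_fix_type[of "sqrt DIM('a) * c"])
  have "dist (f x) (f y) \<le> sqrt DIM('a) * c * dist x y" for x y
  proof -
    have "norm (f x - f y) \<le> sqrt DIM('a) * infnorm (f x - f y)" by (rule norm_le_infnorm)
    also have "\<dots> \<le> sqrt DIM('a) * (c * infnorm (x - y))"
      by (intro mult_left_mono lip) simp
    also have "\<dots> \<le> sqrt DIM('a) * (c * norm (x - y))"
      using assms(1) by (intro mult_left_mono infnorm_le_norm) auto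
    finally show ?thesis by (simp add: dist_norm mult.assoc)
  qed
  then show "\<forall>x y. dist (f x) (f y) \<le> sqrt DIM('a) * c * dist x y" by blast
qed (use assms in auto)

text \<open>Independence of the time step is expressed by the order of quantifiers: \<delta>,
  \<alpha>1 and \<alpha>2 are chosen before \<Delta>, the mesh, the cell, the basis and the data
  \<open>un\<close> and \<open>u0\<close>.\<close>

theorem theorem6:
  fixes F :: "real^'q \<Rightarrow> real^'d^'q"
    and S :: "real^'d \<Rightarrow> real^'q \<Rightarrow> real^'q"
    and \<Omega> :: "(real^'d) set"
    and M :: nat
    and C\<theta> C0 C\<tau> CB :: real
  assumes "bounded \<Omega>"
    and "F differentiable_on UNIV"
  shows "\<exists>\<delta>>0. \<exists>\<alpha>1>0. \<exists>\<alpha>2\<ge>0.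
    \<forall>\<Delta> tn T K h (\<theta> :: 'l::finite \<Rightarrow> real^'d \<Rightarrow> real \<Rightarrow> real) un (u0 :: real^'q^'l).
      0 < \<Delta> \<and> \<Delta> < \<delta> \<and> 0 \<le> tn \<and>
      tessellation \<Omega> T \<and> K \<in> T \<and> 0 < h \<and>
      space_time_basis M K tn (tn + \<Delta>) \<theta> \<and>
      (\<forall>q. (\<lambda>x. un x $ q) \<in> poly_space M) \<and>
      (\<forall>(u :: real^'q^'l) j. set_integrable lborel (K \<times> {tn..tn + \<Delta>})
          (\<lambda>z. \<theta> j (fst z) (snd z) *\<^sub>R spatial_op F S (\<lambda>y. st_fun \<theta> u y (snd z)) (fst z))) \<and>
      (\<forall>j. \<forall>x\<in>K. \<forall>t\<in>{tn..tn + \<Delta>}. \<bar>\<theta> j x t\<bar> \<le> C\<theta>) \<and>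
      (\<forall>x\<in>K. \<forall>t\<in>{tn..tn + \<Delta>}. \<forall>v w :: real^'q^'l.
          infnorm (spatial_op F S (\<lambda>y. st_fun \<theta> v y t) x - spatial_op F S (\<lambda>y. st_fun \<theta> w y t) x)
            \<le> C0 * infnorm (v - w)) \<and>
      measure lborel K \<le> C\<tau> * h ^ CARD('d) \<and>
      invertible (predB K tn (tn + \<Delta>) \<theta>) \<and>
      induced_infnorm (\<lambda>u :: real^'q^'l. matrix_inv (predB K tn (tn + \<Delta>) \<theta>) ** u)
        \<le> CB / h ^ CARD('d)
      \<longrightarrow>
      (\<exists>!u. L2op F S K tn (tn + \<Delta>) \<theta> un u = 0) \<and>
      (\<forall>v w. infnorm (L1op F S K tn (tn + \<Delta>) \<theta> un u0 v - L1op F S K tn (tn + \<Delta>) \<theta> un u0 w)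
         \<ge> \<alpha>1 * infnorm (v - w)) \<and>
      (\<forall>v w. infnorm ((L1op F S K tn (tn + \<Delta>) \<theta> un u0 v - L2op F S K tn (tn + \<Delta>) \<theta> un v)
                      - (L1op F S K tn (tn + \<Delta>) \<theta> un u0 w - L2op F S K tn (tn + \<Delta>) \<theta> un w))
         \<le> \<alpha>2 * \<Delta> * infnorm (v - w))"
proof -
  \<comment> \<open>\<open>L * \<Delta>\<close> will be a Lipschitz constant, in the infinity norm,
    of the predictor term with the inverse matrix applied.\<close>
  define L where "L = \<bar>CB\<bar> * \<bar>C\<tau>\<bar> * \<bar>C\<theta>\<bar> * \<bar>C0\<bar>"
  define s where "s = sqrt DIM(real^'q^'l)"
  have L: "0 \<le> L" and s: "0 \<le> s" by (simp_all add: L_def s_def)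
  \<comment> \<open>Chosen so that \<Delta> < \<delta> forces \<open>s * L * \<Delta> < 1\<close>,
    the contraction condition in the Euclidean norm. The summand 1 keeps the denominator positive
    when \<open>L = 0\<close>.\<close>
  define \<delta> where "\<delta> = 1 / (s * L + 1)"
  have \<delta>: "0 < \<delta>" using L s by (simp add: \<delta>_def add_nonneg_pos)
  show ?thesis
  proof (rule exI[of _ \<delta>], intro conjI[OF \<delta>], rule exI[of _ 1], intro conjI[OF zero_less_one],
      rule exI[of _ L], intro conjI[OF L] allI impI, elim conjE)
    fix \<Delta> tn T K h and \<theta> :: "'l \<Rightarrow> real^'d \<Rightarrow> real \<Rightarrow> real" and un and u0 :: "real^'q^'l"
    assume \<Delta>: "0 < \<Delta>" "\<Delta> < \<delta>" and T: "tessellation \<Omega> T" "K \<in> T" and h: "0 < h"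
      and int: "\<forall>(u :: real^'q^'l) j. set_integrable lborel (K \<times> {tn..tn + \<Delta>})
          (\<lambda>z. \<theta> j (fst z) (snd z) *\<^sub>R spatial_op F S (\<lambda>y. st_fun \<theta> u y (snd z)) (fst z))"
      and \<theta>: "\<forall>j. \<forall>x\<in>K. \<forall>t\<in>{tn..tn + \<Delta>}. \<bar>\<theta> j x t\<bar> \<le> C\<theta>"
      and E: "\<forall>x\<in>K. \<forall>t\<in>{tn..tn + \<Delta>}. \<forall>v w :: real^'q^'l.
          infnorm (spatial_op F S (\<lambda>y. st_fun \<theta> v y t) x - spatial_op F S (\<lambda>y. st_fun \<theta> w y t) x)
            \<le> C0 * infnorm (v - w)"
      and \<tau>: "measure lborel K \<le> C\<tau> * h ^ CARD('d)"
      and B: "induced_infnorm (\<lambda>u :: real^'q^'l. matrix_inv (predB K tn (tn + \<Delta>) \<theta>) ** u)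
        \<le> CB / h ^ CARD('d)"
    let ?A = "matrix_inv (predB K tn (tn + \<Delta>) \<theta>)"
    let ?r = "predr K tn \<theta> un :: real^'q^'l"
    let ?\<phi> = "predphi F S K tn (tn + \<Delta>) \<theta> :: real^'q^'l \<Rightarrow> _"
    let ?L1 = "L1op F S K tn (tn + \<Delta>) \<theta> un u0" and ?L2 = "L2op F S K tn (tn + \<Delta>) \<theta> un"
    have K: "compact K"
      using T by (auto simp: tessellation_def intro: polytope_imp_compact)
    \<comment> \<open>This one estimate serves both the contraction argument and the third
      claim.\<close>
    have lip: "infnorm (?A ** (?\<phi> v - ?\<phi> w)) \<le> L * \<Delta> * infnorm (v - w)" for v w
    proof -
      have "infnorm (?\<phi> v - ?\<phi> w)
          \<le> \<bar>C\<theta>\<bar> * \<bar>C0\<bar> * infnorm (v - w) * (measure lborel K * (tn + \<Delta> - tn))"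
        using \<Delta> int \<theta> E by (intro infnorm_predphi_diff_le K) auto
      also have "\<dots> \<le> \<bar>C\<theta>\<bar> * \<bar>C0\<bar> * infnorm (v - w) * (\<bar>C\<tau>\<bar> * h ^ CARD('d) * \<Delta>)"
      proof -
        have "C\<tau> * h ^ CARD('d) \<le> \<bar>C\<tau>\<bar> * h ^ CARD('d)"
          using h by (intro mult_right_mono) auto
        with \<tau> \<Delta>(1) show ?thesis
          by (intro mult_left_mono) (auto simp: infnorm_pos_le)
      qed
      finally have \<phi>: "infnorm (?\<phi> v - ?\<phi> w)
          \<le> \<bar>C\<theta>\<bar> * \<bar>C0\<bar> * infnorm (v - w) * (\<bar>C\<tau>\<bar> * h ^ CARD('d) * \<Delta>)" .
      have "CB / h ^ CARD('d) \<le> \<bar>CB\<bar> / h ^ CARD('d)"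
        using h by (intro divide_right_mono) auto
      with B have B': "induced_infnorm (\<lambda>u :: real^'q^'l. ?A ** u) \<le> \<bar>CB\<bar> / h ^ CARD('d)"
        by linarith
      have "infnorm (?A ** (?\<phi> v - ?\<phi> w))
          \<le> induced_infnorm (\<lambda>u :: real^'q^'l. ?A ** u) * infnorm (?\<phi> v - ?\<phi> w)"
        by (rule infnorm_le_induced_infnorm[OF linear_matrix_mult_left])
      also have "\<dots> \<le> \<bar>CB\<bar> / h ^ CARD('d) *
          (\<bar>C\<theta>\<bar> * \<bar>C0\<bar> * infnorm (v - w) * (\<bar>C\<tau>\<bar> * h ^ CARD('d) * \<Delta>))"
        using h by (intro mult_mono B' \<phi>) (auto simp: infnorm_pos_le)
      \<comment> \<open>Here the powers of \<open>h\<close> cancel, which makes \<open>L\<close>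
        independent of the mesh.\<close>
      also have "\<dots> = L * \<Delta> * infnorm (v - w)"
        using h by (simp add: L_def field_simps)
      finally show ?thesis .
    qed
    \<comment> \<open>The zeros of \<open>?L2\<close> are exactly the fixed points of this
      map.\<close>
    have "\<exists>!u. ?A ** (?r - ?\<phi> u) = u"
    proof (rule infnorm_contraction_fixpoint[of "L * \<Delta>"])
      have "\<Delta> * (s * L + 1) < 1"
        using \<Delta>(2) L s by (simp add: \<delta>_def pos_less_divide_eq add_nonneg_pos)
      then show "sqrt DIM(real^'q^'l) * (L * \<Delta>) < 1"
        using \<Delta>(1) unfolding s_def[symmetric] by (simp add: algebra_simps)
      \<comment> \<open>The term \<open>?r\<close> cancels and the minus sign exchanges
        \<open>v\<close> and \<open>w\<close>, hence the instance
        \<open>lip[of w v]\<close>.\<close>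
      show "infnorm (?A ** (?r - ?\<phi> v) - ?A ** (?r - ?\<phi> w)) \<le> L * \<Delta> * infnorm (v - w)" for v w
        using lip[of w v] by (simp add: infnorm_sub flip: matrix_diff_ldistrib)
    qed (use L \<Delta> in auto)
    moreover have "?L2 u = 0 \<longleftrightarrow> ?A ** (?r - ?\<phi> u) = u" for u
      by (auto simp: L2op_def)
    ultimately have 1: "\<exists>!u. ?L2 u = 0" by simp
    \<comment> \<open>\<open>?L1\<close> is a translation, since its predictor term is frozen at
      \<open>u0\<close>; the bound holds with equality.\<close>
    have 2: "infnorm (?L1 v - ?L1 w) \<ge> 1 * infnorm (v - w)" for v w
      by (simp add: L1op_def)
    \<comment> \<open>Both the terms with \<open>?r\<close> and those with \<open>?\<phi> u0\<close>
      cancel.\<close>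
    have "(?L1 v - ?L2 v) - (?L1 w - ?L2 w) = ?A ** (?\<phi> w - ?\<phi> v)" for v w
      by (simp add: L1op_def L2op_def matrix_diff_ldistrib)
    then have 3: "infnorm ((?L1 v - ?L2 v) - (?L1 w - ?L2 w)) \<le> L * \<Delta> * infnorm (v - w)" for v w
      using lip[of w v] by (simp add: infnorm_sub)
    with 1 2 show "(\<exists>!u. ?L2 u = 0) \<and>
      (\<forall>v w. infnorm (?L1 v - ?L1 w) \<ge> 1 * infnorm (v - w)) \<and>
      (\<forall>v w. infnorm ((?L1 v - ?L2 v) - (?L1 w - ?L2 w)) \<le> L * \<Delta> * infnorm (v - w))"
      by blast
  qed
qed

end
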